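(* Let $d_x,d_y\in\mathbb N$ and let $\mathcal K\subset\mathbb R^{d_x}$ be a compact domain (a compact set with nonempty interior). For $w\in\mathbb N$, $\textsc{ReLU}$+$\textsc{Step}$ networks of width $w$ are dense in $C(\mathcal K,\mathbb{R}^{d_y})$ if and only if $w\ge \max\{d_x+1, d_y\}$.
   Context: $\textsc{ReLU}(x)=\max\{x,0\}$ and $\textsc{Step}(x)=\mathbf 1[x\ge 0]$. A $\textsc{ReLU}$+$\textsc{Step}$ network $f:\mathbb R^{d_x}\to\mathbb R^{d_y}$ with $L$ layers and hidden dimensions $d_1,\dots,d_{L-1}$ (set $d_0=d_x$, $d_L=d_y$) is a map $f=t_L\circ\sigma_{L-1}\circ\cdots\circ t_2\circ\sigma_1\circ t_1$, where each $t_\ell:\mathbb R^{d_{\ell-1}}\to\mathbb R^{d_\ell}$ is affine and $\sigma_\ell(x_1,\dots,x_{d_\ell})=(\rho_1(x_1),\dots,\rho_{d_\ell}(x_{d_\ell}))$ with each $\rho_i\in\{\textsc{ReLU},\textsc{Step}\}$ chosen independently per neuron. The width is $\max\{d_1,\dots,d_{L-1}\}$; depth is arbitrary. $C(\mathcal K,\mathbb R^{d_y})$ carries the uniform norm $\sup_{x\in\mathcal K}\|g(x)\|_\infty$, and "dense" means: for every $f^*\in C(\mathcal K,\mathbb R^{d_y})$ and $\varepsilon>0$ there is such a network $f$ with $\sup_{x\in\mathcal K}\|f^*(x)-f(x)\|_\infty\le\varepsilon$. *)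

theory Defs
  imports "HOL-Analysis.Analysis"
begin

definition act :: "bool \<Rightarrow> real \<Rightarrow> real" where
  "act r t = (if r then max t 0 else (if t \<ge> 0 then 1 else 0))"

text \<open>Hidden vectors of dimension d are represented as functions nat \<Rightarrow> real,
  only the entries below d being meaningful (the others are set to 0).
  A middle layer is (d_out, W, b, rho): it maps h (of dimension d_in) to
  the vector  i \<mapsto> rho_i (sum_{j<d_in} W i j * h j + b i)  for i < d_out.\<close>
fun hidden_apply ::
  "nat \<Rightarrow> (nat \<times> (nat \<Rightarrow> nat \<Rightarrow> real) \<times> (nat \<Rightarrow> real) \<times> (nat \<Rightarrow> bool)) list
   \<Rightarrow> (nat \<Rightarrow> real) \<Rightarrow> nat \<times> (nat \<Rightarrow> real)" where
  "hidden_apply din [] h = (din, h)"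
| "hidden_apply din ((d, W, b, rho) # Ls) h =
     hidden_apply d Ls (\<lambda>i. if i < d then act (rho i) ((\<Sum>j<din. W i j * h j) + b i) else 0)"

definition relu_step_net ::
  "nat \<Rightarrow> (nat \<Rightarrow> 'n::finite \<Rightarrow> real) \<Rightarrow> (nat \<Rightarrow> real) \<Rightarrow> (nat \<Rightarrow> bool)
   \<Rightarrow> (nat \<times> (nat \<Rightarrow> nat \<Rightarrow> real) \<times> (nat \<Rightarrow> real) \<times> (nat \<Rightarrow> bool)) list
   \<Rightarrow> ('m::finite \<Rightarrow> nat \<Rightarrow> real) \<Rightarrow> ('m \<Rightarrow> real)
   \<Rightarrow> real^'n \<Rightarrow> real^'m" where
  "relu_step_net d1 W1 b1 rho1 Ls WL bL x =
     (let h1 = (\<lambda>i. if i < d1 then act (rho1 i) ((\<Sum>j\<in>UNIV. W1 i j * x $ j) + b1 i) else 0);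
          (dlast, h) = hidden_apply d1 Ls h1
      in \<chi> k. (\<Sum>j<dlast. WL k j * h j) + bL k)"

definition net_width ::
  "nat \<Rightarrow> (nat \<times> (nat \<Rightarrow> nat \<Rightarrow> real) \<times> (nat \<Rightarrow> real) \<times> (nat \<Rightarrow> bool)) list \<Rightarrow> nat" where
  "net_width d1 Ls = Max (set (d1 # map fst Ls))"

definition relu_step_nets_of_width :: "nat \<Rightarrow> (real^'n::finite \<Rightarrow> real^'m::finite) set" where
  "relu_step_nets_of_width w =
     {relu_step_net d1 W1 b1 rho1 Ls WL bL | d1 W1 b1 rho1 Ls WL bL. net_width d1 Ls = w}"

definition dense_in_C :: "(real^'n::finite) set \<Rightarrow> (real^'n \<Rightarrow> real^'m::finite) set \<Rightarrow> bool" where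
  "dense_in_C K F \<longleftrightarrow>
     (\<forall>f. continuous_on K f \<longrightarrow> (\<forall>\<epsilon>>0. \<exists>g\<in>F. \<forall>x\<in>K. \<forall>i. \<bar>f x $ i - g x $ i\<bar> \<le> \<epsilon>))"

end

theory Submission
  imports Defs
begin

text \<open>
  Lower bounds. If no layer is wider than the input dimension, then for every bounded open set U
  and every point p of U some frontier point q satisfies g q \<le> g p. By induction on the layers:
  either the first layer is constant on a ray from p, or it is locally an invertible affine map at p
  and the claim for the remaining layers, applied to the part of the image of U in the positive
  orthant, yields a point that is on the frontier of the image or from which a ray with constant
  layer value starts. This contradicts approximation of the distance to p. If the last hidden layer
  is narrower than the output dimension, the range lies in a fixed hyperplane.

  Upper bound. Without loss the network overwrites one coordinate of its state at a time by an
  affine functional, possibly followed by an activation. One spare coordinate suffices to round all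
  input coordinates to finitely many values; a generic linear functional then encodes the rounded
  input injectively as a single real u. Since max y (L u) and min y (L u), with L affine, only
  overwrite y, any coordinate other than that of u can be replaced by an arbitrary function of u.
\<close>

section \<open>Width at least the input dimension plus one\<close>

inductive_set narrow_nets :: "(real^'n \<Rightarrow> real) set" where
  affine: "(\<lambda>x. a \<bullet> x + c) \<in> narrow_nets"
| layer: "g \<in> narrow_nets \<Longrightarrow> (\<lambda>x. g (\<chi> i. act (\<rho> i) ((A *v x + b) $ i))) \<in> narrow_nets"

lemma layer_constant_ray:
  fixes A :: "real^'n^'n" and b :: "real^'n"
  assumes "open U" "bounded U" "p \<in> U" and inv: "A ** B = mat 1"
    and free: "\<not> \<rho> i \<or> (A *v p + b) $ i \<le> 0"
  shows "\<exists>q\<in>frontier U. (\<chi> i. act (\<rho> i) ((A *v q + b) $ i)) = (\<chi> i. act (\<rho> i) ((A *v p + b) $ i))"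
proof -
  define s :: real where "s = (if (A *v p + b) $ i \<le> 0 \<and> (\<rho> i \<or> (A *v p + b) $ i < 0) then -1 else 1)"
  define v where "v = B *v (s *\<^sub>R axis i 1)"
  have Av: "A *v v = s *\<^sub>R axis i 1"
    unfolding v_def by (simp add: matrix_vector_mul_assoc inv)
  have "v \<noteq> 0"
  proof
    assume "v = 0"
    then have "s *\<^sub>R axis i (1::real) = (0 :: real^'n)" using Av by (metis matrix_vector_mult_0_right)
    then show False by (auto simp: s_def axis_eq_0_iff split: if_splits)
  qed
  then obtain d where d: "0 < d" "p + d *\<^sub>R v \<in> frontier U"
    using ray_to_frontier[of U p v] assms by (metis interior_open)
  have eq: "A *v (p + d *\<^sub>R v) + b = (A *v p + b) + (d * s) *\<^sub>R axis i 1"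
    by (simp add: matrix_vector_right_distrib matrix_vector_mult_scaleR Av)
  have "act (\<rho> j) ((A *v (p + d *\<^sub>R v) + b) $ j) = act (\<rho> j) ((A *v p + b) $ j)" for j
  proof (cases "j = i")
    case False
    then show ?thesis unfolding eq by (simp add: axis_def)
  next
    case True
    show ?thesis
      unfolding eq True using free d(1) by (auto simp: axis_def act_def s_def)
  qed
  then show ?thesis using d(2) by (intro bexI[of _ "p + d *\<^sub>R v"]) auto
qed

text \<open>The one-sided inequality, rather than a level set reaching the frontier, is what makes the
  affine base case work in dimension one too.\<close>
lemma narrow_net_frontier_le:
  fixes g :: "real^'n \<Rightarrow> real"
  assumes "g \<in> narrow_nets" "open U" "bounded U" "p \<in> U"
  shows "\<exists>q\<in>frontier U. g q \<le> g p"
  using assms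
proof (induction arbitrary: U p)
  case (affine a c)
  define v where "v = (if a = 0 then axis undefined 1 else - a)"
  have "v \<noteq> 0" "a \<bullet> v \<le> 0" by (auto simp: v_def axis_eq_0_iff)
  with affine obtain d where d: "0 < d" "p + d *\<^sub>R v \<in> frontier U"
    using ray_to_frontier[of U p v] by (metis interior_open)
  have "a \<bullet> (p + d *\<^sub>R v) + c \<le> a \<bullet> p + c"
    using \<open>a \<bullet> v \<le> 0\<close> d(1) by (simp add: inner_add_right mult_nonneg_nonpos)
  then show ?case using d(2) by blast
next
  case (layer g \<rho> A b)
  let ?y = "\<lambda>x. A *v x + b"
  let ?L = "\<lambda>x. (\<chi> i. act (\<rho> i) (?y x $ i))"
  show ?case
  proof (cases "inj ((*v) A)")
    case False
    then obtain v where v: "v \<noteq> 0" "A *v v = 0"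
      using linear_injective_0[OF matrix_vector_mul_linear[of A]] by auto
    with layer.prems obtain d where d: "0 < d" "p + d *\<^sub>R v \<in> frontier U"
      using ray_to_frontier[of U p v] by (metis interior_open)
    have "?y (p + d *\<^sub>R v) = ?y p"
      by (simp add: matrix_vector_right_distrib matrix_vector_mult_scaleR v)
    then show ?thesis using d(2) by (intro bexI[of _ "p + d *\<^sub>R v"]) auto
  next
    case inj: True
    then obtain B where B: "B ** A = mat 1" using matrix_left_invertible_injective[of A] by auto
    then have AB: "A ** B = mat 1" by (simp add: matrix_left_right_inverse)
    show ?thesis
    proof (cases "\<exists>i. \<not> \<rho> i \<or> ?y p $ i \<le> 0")
      case True
      then obtain i where "\<not> \<rho> i \<or> ?y p $ i \<le> 0" by blast
      then obtain q where "q \<in> frontier U" "?L q = ?L p"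
        using layer_constant_ray[OF layer.prems AB, of \<rho> i b] by blast
      then show ?thesis by (intro bexI[of _ q]) auto
    next
      case False
      then have relu: "\<And>i. \<rho> i" and pos: "\<And>i. 0 < ?y p $ i" by (auto simp: not_le)
      have Lid: "?L x = ?y x" if "\<And>i. 0 \<le> ?y x $ i" for x
        using that relu by (simp add: act_def vec_eq_iff)
      define V where "V = (+) b ` ((*v) A ` U)"
      define P where "P = {z::real^'n. \<forall>i. 0 < z $ i}"
      have lin: "linear ((*v) A)" by (rule matrix_vector_mul_linear)
      have surj: "surj ((*v) A)" using inj lin linear_injective_imp_surjective by blast
      have "open V" unfolding V_def
        using open_surjective_linear_image[OF layer.prems(1) lin surj] by (simp add: open_translation)
      have "bounded V" unfolding V_def
        using layer.prems(2) lin by (intro bounded_translation bounded_linear_image) (auto simp: linear_conv_bounded_linear)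
      have "P = (\<Inter>i. {z. 0 < z $ i})" by (auto simp: P_def)
      then have "open P" by (auto intro!: open_INT open_Collect_less continuous_intros)
      have "closure P \<subseteq> {z. \<forall>i. 0 \<le> z $ i}"
      proof (rule closure_minimal)
        show "closed {z::real^'n. \<forall>i. 0 \<le> z $ i}"
          by (intro closed_Collect_all closed_Collect_le continuous_intros)
      qed (auto simp: P_def less_imp_le)
      have "?y p \<in> V \<inter> P" using layer.prems(3) pos by (auto simp: V_def P_def add.commute)
      moreover have "open (V \<inter> P)" "bounded (V \<inter> P)"
        using \<open>open V\<close> \<open>open P\<close> \<open>bounded V\<close> by (auto intro: bounded_Int)
      ultimately obtain z where z: "z \<in> frontier (V \<inter> P)" "g z \<le> g (?y p)"
        using layer.IH by blast
      have zcl: "z \<in> closure V" "z \<in> closure P"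
        using z(1) closure_mono[of "V \<inter> P" V] closure_mono[of "V \<inter> P" P] by (auto simp: frontier_def)
      have "z \<notin> V \<inter> P" using z(1) interior_open[OF \<open>open (V \<inter> P)\<close>] by (simp only: frontier_def) blast
      have "z \<in> (+) b ` ((*v) A ` closure U)"
        using zcl(1) unfolding V_def closure_translation
        by (simp add: closure_injective_linear_image[OF lin inj])
      then obtain x where x: "x \<in> closure U" "z = ?y x" by (auto simp: add.commute)
      have Lx: "?L x = z"
        using Lid[of x] zcl(2) \<open>closure P \<subseteq> _\<close> x(2) by auto
      have Lp: "?L p = ?y p" using Lid[of p] pos by (simp add: less_imp_le)
      show ?thesis
      proof (cases "x \<in> U")
        case False
        then have "x \<in> frontier U" using x(1) layer.prems(1) by (simp add: frontier_def interior_open)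
        then show ?thesis using z(2) Lx Lp by (intro bexI[of _ x]) auto
      next
        case True
        then have "z \<in> V" using x(2) by (auto simp: V_def add.commute)
        with \<open>z \<notin> V \<inter> P\<close> obtain i where "?y x $ i \<le> 0" using x(2) by (auto simp: P_def not_less)
        then obtain q where "q \<in> frontier U" "?L q = ?L x"
          using layer_constant_ray[OF layer.prems(1,2) True AB, of \<rho> i b] by blast
        then show ?thesis using z(2) Lx Lp by (intro bexI[of _ q]) auto
      qed
    qed
  qed
qed

lemma hidden_apply_narrow:
  fixes e :: "nat \<Rightarrow> 'n::finite"
  assumes e: "bij_betw e {..<CARD('n)} UNIV"
    and "d \<le> CARD('n)" "\<forall>L\<in>set Ls. fst L \<le> CARD('n)"
  shows "(\<lambda>z. case hidden_apply d Ls (\<lambda>i. if i < d then z $ e i else 0) of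
      (dl, h) \<Rightarrow> (\<Sum>j<dl. c j * h j) + \<beta>) \<in> (narrow_nets :: (real^'n \<Rightarrow> real) set)"
  using assms(2,3)
proof (induction Ls arbitrary: d)
  have reindex: "(\<Sum>j<d. f j * z $ e j) = (\<Sum>k\<in>UNIV. (if inv_into {..<CARD('n)} e k < d then f (inv_into {..<CARD('n)} e k) else 0) * z $ k)"
    if "d \<le> CARD('n)" for f d and z :: "real^'n"
  proof -
    have "(\<Sum>k\<in>UNIV. (if inv_into {..<CARD('n)} e k < d then f (inv_into {..<CARD('n)} e k) else 0) * z $ k)
      = (\<Sum>j<CARD('n). (if j < d then f j else 0) * z $ e j)"
      using e by (subst sum.reindex_bij_betw[OF e, symmetric])
        (auto simp: bij_betw_inv_into_left intro!: sum.cong)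
    also have "\<dots> = (\<Sum>j<d. f j * z $ e j)"
      using that by (intro sum.mono_neutral_cong_right) auto
    finally show ?thesis by simp
  qed
  {
    case Nil
    show ?case
      using narrow_nets.affine[of "\<chi> k. if inv_into {..<CARD('n)} e k < d then c (inv_into {..<CARD('n)} e k) else 0" \<beta>]
        reindex[OF Nil(1), of c]
      by (simp add: inner_vec_def)
  next
    case (Cons L Ls)
    obtain d' W b \<rho> where L: "L = (d', W, b, \<rho>)" by (cases L)
    have d': "d' \<le> CARD('n)" using Cons.prems L by simp
    let ?e = "inv_into {..<CARD('n)} e"
    let ?A = "(\<chi> k l. if ?e l < d then W (?e k) (?e l) else 0) :: real^'n^'n"
    let ?lay = "\<lambda>z. (\<chi> k. act (\<rho> (?e k)) ((?A *v z + (\<chi> k. b (?e k))) $ k))"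
    have eq: "(\<lambda>i. if i < d' then act (\<rho> i) ((\<Sum>j<d. W i j * (if j < d then z $ e j else 0)) + b i) else 0)
      = (\<lambda>i. if i < d' then ?lay z $ e i else 0)" for z
    proof
      fix i
      have "?e (e i) = i" if "i < d'"
        using that d' e by (intro bij_betw_inv_into_left[OF e]) auto
      then have lay: "?lay z $ e i = act (\<rho> i) ((\<Sum>k\<in>UNIV. (if ?e k < d then W i (?e k) else 0) * z $ k) + b i)"
        if "i < d'"
        unfolding matrix_vector_mult_def vector_add_component vec_lambda_beta by (simp only: that)
      have "(\<Sum>j<d. W i j * (if j < d then z $ e j else 0)) = (\<Sum>j<d. W i j * z $ e j)"
        by (intro sum.cong) auto
      then show "(if i < d' then act (\<rho> i) ((\<Sum>j<d. W i j * (if j < d then z $ e j else 0)) + b i) else 0)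
        = (if i < d' then ?lay z $ e i else 0)"
        using reindex[OF Cons.prems(1), of "W i" z] lay by (simp only: cong: if_cong)
    qed
    have "\<forall>L\<in>set Ls. fst L \<le> CARD('n)" using Cons.prems by simp
    from narrow_nets.layer[OF Cons.IH[OF d' this], of "\<lambda>k. \<rho> (?e k)" ?A "\<chi> k. b (?e k)"]
    show ?case unfolding L hidden_apply.simps eq .
  }
qed

lemma net_width_le_imp:
  assumes "net_width d1 Ls \<le> w"
  shows "d1 \<le> w" "\<forall>L\<in>set Ls. fst L \<le> w"
  using assms by (auto simp: net_width_def)

lemma relu_step_net_narrow:
  fixes W1 :: "nat \<Rightarrow> 'n::finite \<Rightarrow> real"
  assumes "net_width d1 Ls \<le> CARD('n)"
  shows "(\<lambda>x. relu_step_net d1 W1 b1 rho1 Ls WL bL x $ k) \<in> narrow_nets"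
proof -
  obtain e :: "nat \<Rightarrow> 'n" where e: "bij_betw e {..<CARD('n)} UNIV"
    using ex_bij_betw_nat_finite[of "UNIV :: 'n set"] by (auto simp: atLeast0LessThan)
  let ?e = "inv_into {..<CARD('n)} e"
  note dims = net_width_le_imp[OF assms]
  let ?A = "(\<chi> k l. W1 (?e k) l) :: real^'n^'n"
  let ?lay = "\<lambda>z. (\<chi> k. act (rho1 (?e k)) ((?A *v z + (\<chi> k. b1 (?e k))) $ k))"
  have eq: "(\<lambda>i. if i < d1 then act (rho1 i) ((\<Sum>j\<in>UNIV. W1 i j * x $ j) + b1 i) else 0)
      = (\<lambda>i. if i < d1 then ?lay x $ e i else 0)" for x
  proof
    fix i
    have "?e (e i) = i" if "i < d1"
      using that dims by (intro bij_betw_inv_into_left[OF e]) auto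
    then show "(if i < d1 then act (rho1 i) ((\<Sum>j\<in>UNIV. W1 i j * x $ j) + b1 i) else 0)
        = (if i < d1 then ?lay x $ e i else 0)"
      by (simp add: matrix_vector_mult_def)
  qed
  from narrow_nets.layer[OF hidden_apply_narrow[OF e dims, of "WL k" "bL k"], of "\<lambda>k. rho1 (?e k)" ?A "\<chi> k. b1 (?e k)"]
  show ?thesis unfolding relu_step_net_def Let_def eq by (simp add: case_prod_beta)
qed

lemma dense_imp_width_gt_input:
  fixes K :: "(real^'n) set"
  assumes "interior K \<noteq> {}"
    and dense: "dense_in_C K (relu_step_nets_of_width w :: (real^'n \<Rightarrow> real^'m) set)"
  shows "CARD('n) + 1 \<le> w"
proof (rule ccontr)
  assume "\<not> CARD('n) + 1 \<le> w"
  then have w: "w \<le> CARD('n)" by simp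
  obtain p where "p \<in> interior K" using assms(1) by blast
  then obtain r where r: "0 < r" "cball p r \<subseteq> K" by (auto simp: mem_interior_cball)
  define f :: "real^'n \<Rightarrow> real^'m" where "f = (\<lambda>x. \<chi> k. norm (x - p))"
  have "continuous_on K f" unfolding f_def by (intro continuous_intros)
  then obtain g where g: "g \<in> (relu_step_nets_of_width w :: (real^'n \<Rightarrow> real^'m) set)"
      "\<forall>x\<in>K. \<forall>i. \<bar>f x $ i - g x $ i\<bar> \<le> r / 3"
    using dense[unfolded dense_in_C_def, rule_format, of f "r / 3"] r(1) by auto
  obtain k :: 'm where True by blast
  have "(\<lambda>x. g x $ k) \<in> narrow_nets"
    using g(1) w by (auto simp: relu_step_nets_of_width_def intro!: relu_step_net_narrow)
  from narrow_net_frontier_le[OF this, of "ball p r" p] r(1)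
  obtain q where q: "q \<in> sphere p r" "g q $ k \<le> g p $ k" by auto
  have "norm (q - p) = r" using q(1) by (simp add: dist_norm norm_minus_commute)
  moreover have "q \<in> K" "p \<in> K" using q(1) r by auto
  ultimately have "\<bar>r - g q $ k\<bar> \<le> r / 3" "\<bar>g p $ k\<bar> \<le> r / 3"
    using g(2) by (fastforce simp: f_def)+
  then show False using q(2) r(1) by linarith
qed

section \<open>Width at least the output dimension\<close>

lemma fst_hidden_apply_le:
  "d \<le> w \<Longrightarrow> \<forall>L\<in>set Ls. fst L \<le> w \<Longrightarrow> fst (hidden_apply d Ls h) \<le> w"
  by (induction d Ls h rule: hidden_apply.induct) auto

lemma fst_hidden_apply_indep: "fst (hidden_apply d Ls h) = fst (hidden_apply d Ls h')"
  by (induction Ls arbitrary: d h h') auto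

lemma thin_net_range_in_hyperplane:
  fixes g :: "real^'n \<Rightarrow> real^'m"
  assumes "g \<in> relu_step_nets_of_width w" "w < CARD('m)"
  shows "\<exists>v. v \<noteq> 0 \<and> (\<forall>x y. v \<bullet> (g x - g y) = 0)"
proof -
  obtain d1 W1 b1 rho1 Ls WL bL where g: "g = relu_step_net d1 W1 b1 rho1 Ls WL bL"
    and "net_width d1 Ls = w"
    using assms(1) by (auto simp: relu_step_nets_of_width_def)
  then have dims: "d1 \<le> w" "\<forall>L\<in>set Ls. fst L \<le> w" using net_width_le_imp[of d1 Ls w] by auto
  define D where "D = fst (hidden_apply d1 Ls (\<lambda>_. 0))"
  have D: "fst (hidden_apply d1 Ls h) = D" for h unfolding D_def by (rule fst_hidden_apply_indep)
  have "D \<le> w" unfolding D_def using fst_hidden_apply_le[OF dims] .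
  let ?col = "\<lambda>j. (\<chi> k. WL k j) :: real^'m"
  have "dim (?col ` {..<D}) \<le> card (?col ` {..<D})" by (intro dim_le_card') simp
  also have "\<dots> \<le> D" using card_image_le[of "{..<D}" ?col] by simp
  finally have dim: "dim (?col ` {..<D}) < DIM(real^'m)" using \<open>D \<le> w\<close> assms(2) by simp
  obtain v where v: "v \<noteq> 0"
    "\<And>y. y \<in> span (?col ` {..<D}) \<Longrightarrow> orthogonal v y"
    by (rule orthogonal_to_subspace_exists[OF dim]) (rule that)
  have orth: "v \<bullet> ?col j = 0" if "j < D" for j
  proof -
    have "?col j \<in> span (?col ` {..<D})" using that by (intro span_base imageI) simp
    from v(2)[OF this] show ?thesis by (simp add: orthogonal_def)
  qed
  have "\<exists>c. g x = (\<Sum>j<D. c j *\<^sub>R ?col j) + (\<chi> k. bL k)" for x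
  proof -
    let ?h1 = "\<lambda>i. if i < d1 then act (rho1 i) ((\<Sum>j\<in>UNIV. W1 i j * x $ j) + b1 i) else 0"
    have "g x = (\<Sum>j<D. snd (hidden_apply d1 Ls ?h1) j *\<^sub>R ?col j) + (\<chi> k. bL k)"
      unfolding g relu_step_net_def Let_def
      by (simp add: case_prod_beta D vec_eq_iff mult.commute)
    then show ?thesis by blast
  qed
  then obtain c where c: "\<And>x. g x = (\<Sum>j<D. c x j *\<^sub>R ?col j) + (\<chi> k. bL k)" by metis
  have "v \<bullet> g x = v \<bullet> (\<chi> k. bL k)" for x
    unfolding c inner_add_right inner_sum_right inner_scaleR_right by (simp add: orth)
  then show ?thesis using v(1) by (auto simp: inner_diff_right)
qed

lemma dense_imp_width_ge_output:
  fixes K :: "(real^'n) set"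
  assumes "interior K \<noteq> {}"
    and dense: "dense_in_C K (relu_step_nets_of_width w :: (real^'n \<Rightarrow> real^'m) set)"
  shows "CARD('m) \<le> w"
proof (rule ccontr)
  assume "\<not> CARD('m) \<le> w"
  then have w: "w < CARD('m)" by simp
  obtain p where "p \<in> interior K" using assms(1) by blast
  then obtain r where r: "0 < r" "cball p r \<subseteq> K" by (auto simp: mem_interior_cball)
  obtain e :: "'m \<Rightarrow> nat" where e: "bij_betw e UNIV {..<CARD('m)}"
    using ex_bij_betw_finite_nat[of "UNIV :: 'm set"] by (auto simp: atLeast0LessThan)
  obtain i0 :: 'n where True by blast
  define M where "M = real CARD('m)"
  have M: "M > 0" by (simp add: M_def)
  define s where "s = r / M"
  have s: "s > 0" using r M by (simp add: s_def)
  define pt where "pt = (\<lambda>N::nat. p + (s * real N) *\<^sub>R axis i0 (1::real))"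
  have ptK: "pt N \<in> K" if "N \<le> CARD('m)" for N
  proof -
    have "s * real N \<le> r" using that M r(1) by (simp add: s_def M_def field_simps)
    then have "pt N \<in> cball p r" using s by (simp add: pt_def dist_norm)
    then show ?thesis using r by blast
  qed
  define f :: "real^'n \<Rightarrow> real^'m" where
    "f = (\<lambda>x. \<chi> k. max 0 (1 - \<bar>(x $ i0 - p $ i0) / s - real (e k + 1)\<bar>))"
  have fpt: "f (pt N) $ k = (if N = e k + 1 then 1 else 0)" for N k
  proof -
    have "(pt N $ i0 - p $ i0) / s = real N" using s by (simp add: pt_def)
    moreover have "\<bar>real N - real (e k + 1)\<bar> \<ge> 1" if "N \<noteq> e k + 1" using that by linarith
    ultimately show ?thesis by (auto simp: f_def)
  qed
  have "continuous_on K f" unfolding f_def using s by (intro continuous_intros) auto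
  moreover have "1 / (4 * M) > 0" using M by simp
  ultimately obtain g where g: "g \<in> (relu_step_nets_of_width w :: (real^'n \<Rightarrow> real^'m) set)"
      "\<forall>x\<in>K. \<forall>i. \<bar>f x $ i - g x $ i\<bar> \<le> 1 / (4 * M)"
    using dense[unfolded dense_in_C_def, rule_format, of f "1 / (4 * M)"] by auto
  obtain v where v: "v \<noteq> 0" "\<And>x y. v \<bullet> (g x - g y) = 0"
    using thin_net_range_in_hyperplane[OF g(1) w] by blast
  define T where "T = (\<Sum>k\<in>UNIV. \<bar>v $ k\<bar>)"
  have T: "T > 0"
  proof -
    obtain k where "v $ k \<noteq> 0" using v(1) by (auto simp: vec_eq_iff)
    then show ?thesis unfolding T_def by (intro sum_pos2[of _ k]) auto
  qed
  have le: "\<bar>v $ k\<bar> \<le> T / (2 * M)" for k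
  proof -
    let ?x = "pt (e k + 1)" and ?y = "pt 0"
    have "e k < CARD('m)" using e by (auto simp: bij_betw_def)
    then have K: "?x \<in> K" "?y \<in> K" using ptK by auto
    have ej: "e j = e k \<longleftrightarrow> j = k" for j using e by (auto simp: bij_betw_def inj_on_def)
    have "(f ?x - f ?y) = axis k 1" by (auto simp: vec_eq_iff axis_def fpt ej dest: sym)
    then have "v $ k = v \<bullet> (f ?x - f ?y)" by (simp add: inner_axis)
    also have "\<dots> = v \<bullet> (f ?x - f ?y - (g ?x - g ?y))"
      using v(2)[of ?x ?y] by (simp add: inner_diff_right)
    finally have "\<bar>v $ k\<bar> \<le> (\<Sum>l\<in>UNIV. \<bar>v $ l\<bar> * \<bar>(f ?x - f ?y - (g ?x - g ?y)) $ l\<bar>)"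
      by (simp add: inner_vec_def flip: abs_mult)
    also have "\<dots> \<le> (\<Sum>l\<in>UNIV. \<bar>v $ l\<bar> * (1 / (2 * M)))"
    proof (intro sum_mono mult_left_mono)
      fix l
      have "\<bar>f ?x $ l - g ?x $ l\<bar> \<le> 1 / (4 * M)" "\<bar>f ?y $ l - g ?y $ l\<bar> \<le> 1 / (4 * M)"
        using g(2) K by blast+
      moreover have "1 / (4 * M) + 1 / (4 * M) = 1 / (2 * M)" using M by (simp add: field_simps)
      ultimately show "\<bar>(f ?x - f ?y - (g ?x - g ?y)) $ l\<bar> \<le> 1 / (2 * M)"
        unfolding vector_minus_component by linarith
    qed simp
    also have "\<dots> = T / (2 * M)" by (simp add: T_def sum_distrib_right[symmetric] sum_divide_distrib)
    finally show ?thesis .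
  qed
  have "T \<le> (\<Sum>k\<in>(UNIV::'m set). T / (2 * M))" by (subst T_def) (rule sum_mono[OF le])
  also have "\<dots> = T / 2" using M by (simp add: M_def)
  finally show False using T by simp
qed

section \<open>Networks as sequences of coordinate updates\<close>

definition hidden_states :: "nat \<Rightarrow> (real^'n::finite \<Rightarrow> nat \<Rightarrow> real) set" where
  "hidden_states w = {h. \<exists>W b \<rho> Ls. (\<forall>L\<in>set Ls. fst L = w) \<and>
     h = (\<lambda>x. snd (hidden_apply w Ls
            (\<lambda>i. if i < w then act (\<rho> i) ((\<Sum>j\<in>UNIV. W i j * x $ j) + b i) else 0)))}"

definition affine_readouts :: "'a set \<Rightarrow> nat \<Rightarrow> ('a \<Rightarrow> nat \<Rightarrow> real) \<Rightarrow> ('a \<Rightarrow> real) set" where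
  "affine_readouts K w h = {g. \<exists>a c. \<forall>x\<in>K. g x = (\<Sum>j<w. a j * h x j) + c}"

definition net_states :: "(real^'n::finite) set \<Rightarrow> nat \<Rightarrow> (real^'n \<Rightarrow> nat \<Rightarrow> real) set" where
  "net_states K w = {G. (\<exists>B. \<forall>x\<in>K. \<forall>i<w. \<bar>G x i\<bar> \<le> B) \<and>
     (\<exists>h\<in>hidden_states w. \<forall>i<w. (\<lambda>x. G x i) \<in> affine_readouts K w h)}"

lemma affine_readouts_const: "(\<lambda>x. c) \<in> affine_readouts K w h"
  unfolding affine_readouts_def by (auto intro!: exI[of _ "\<lambda>_. 0"])

lemma affine_readouts_coord:
  assumes "i < w" shows "(\<lambda>x. h x i) \<in> affine_readouts K w h"
  unfolding affine_readouts_def using assms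
  by (auto intro!: exI[of _ "\<lambda>j. if j = i then 1 else 0"] exI[of _ 0] simp: if_distrib[of "\<lambda>a. a * _"] cong: if_cong)

lemma affine_readouts_add:
  assumes "f \<in> affine_readouts K w h" "g \<in> affine_readouts K w h"
  shows "(\<lambda>x. f x + g x) \<in> affine_readouts K w h"
proof -
  from assms obtain a c a' c' where "\<forall>x\<in>K. f x = (\<Sum>j<w. a j * h x j) + c"
    "\<forall>x\<in>K. g x = (\<Sum>j<w. a' j * h x j) + c'" by (auto simp: affine_readouts_def)
  then have "\<forall>x\<in>K. f x + g x = (\<Sum>j<w. (a j + a' j) * h x j) + (c + c')"
    by (simp add: distrib_right sum.distrib)
  then show ?thesis unfolding affine_readouts_def by (intro CollectI exI)
qed

lemma affine_readouts_mult:
  assumes "f \<in> affine_readouts K w h"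
  shows "(\<lambda>x. r * f x) \<in> affine_readouts K w h"
proof -
  from assms obtain a c where "\<forall>x\<in>K. f x = (\<Sum>j<w. a j * h x j) + c"
    by (auto simp: affine_readouts_def)
  then have "\<forall>x\<in>K. r * f x = (\<Sum>j<w. (r * a j) * h x j) + r * c"
    by (simp add: distrib_left sum_distrib_left mult.assoc)
  then show ?thesis unfolding affine_readouts_def by (intro CollectI exI)
qed

lemma affine_readouts_sum:
  assumes "\<And>i. i \<in> I \<Longrightarrow> f i \<in> affine_readouts K w h"
  shows "(\<lambda>x. \<Sum>i\<in>I. f i x) \<in> affine_readouts K w h"
  using assms
  by (induction I rule: infinite_finite_induct)
    (auto intro: affine_readouts_const affine_readouts_add)

lemma affine_readouts_cong:
  assumes "g \<in> affine_readouts K w h" "\<And>x. x \<in> K \<Longrightarrow> f x = g x"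
  shows "f \<in> affine_readouts K w h"
  using assms by (auto simp: affine_readouts_def)

lemma net_states_cong:
  assumes "G \<in> net_states K w" "\<And>x i. x \<in> K \<Longrightarrow> i < w \<Longrightarrow> H x i = G x i"
  shows "H \<in> net_states K w"
proof -
  from assms(1) obtain B h where B: "\<forall>x\<in>K. \<forall>i<w. \<bar>G x i\<bar> \<le> B" and h: "h \<in> hidden_states w"
    and aff: "\<forall>i<w. (\<lambda>x. G x i) \<in> affine_readouts K w h" by (auto simp: net_states_def)
  show ?thesis unfolding net_states_def
    by (intro CollectI conjI exI[of _ B] bexI[OF _ h])
      (use B aff assms(2) in \<open>auto intro: affine_readouts_cong\<close>)
qed

lemma hidden_apply_append:
  "hidden_apply d (Ls @ Ms) h = (case hidden_apply d Ls h of (d', h') \<Rightarrow> hidden_apply d' Ms h')"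
  by (induction d Ls h rule: hidden_apply.induct) auto

lemma fst_hidden_apply_eq:
  "\<forall>L\<in>set Ls. fst L = w \<Longrightarrow> fst (hidden_apply w Ls h) = w"
  by (induction w Ls h rule: hidden_apply.induct) auto

lemma hidden_states_layer:
  assumes "h \<in> hidden_states w"
  shows "(\<lambda>x i. if i < w then act (\<rho> i) ((\<Sum>j<w. A i j * h x j) + c i) else 0) \<in> hidden_states w"
proof -
  from assms obtain W b r Ls where Ls: "\<forall>L\<in>set Ls. fst L = w"
    and h: "h = (\<lambda>x. snd (hidden_apply w Ls
            (\<lambda>i. if i < w then act (r i) ((\<Sum>j\<in>UNIV. W i j * x $ j) + b i) else 0)))"
    by (auto simp: hidden_states_def)
  show ?thesis unfolding hidden_states_def
    by (intro CollectI exI[of _ W] exI[of _ b] exI[of _ r] exI[of _ "Ls @ [(w, A, c, \<rho>)]"])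
      (use Ls in \<open>auto simp: hidden_apply_append case_prod_beta fst_hidden_apply_eq h fun_eq_iff\<close>)
qed

lemma affine_functional_bounded:
  fixes G :: "'a \<Rightarrow> nat \<Rightarrow> real"
  assumes "\<forall>x\<in>K. \<forall>i<w. \<bar>G x i\<bar> \<le> B"
  shows "\<exists>C. \<forall>x\<in>K. \<bar>(\<Sum>j<w. a j * G x j) + c\<bar> \<le> C"
proof (intro exI ballI)
  fix x assume "x \<in> K"
  have "\<bar>\<Sum>j<w. a j * G x j\<bar> \<le> (\<Sum>j<w. \<bar>a j\<bar> * B)"
    using assms \<open>x \<in> K\<close> by (intro order_trans[OF sum_abs] sum_mono) (auto simp: abs_mult mult_left_mono)
  then show "\<bar>(\<Sum>j<w. a j * G x j) + c\<bar> \<le> (\<Sum>j<w. \<bar>a j\<bar> * B) + \<bar>c\<bar>" by linarith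
qed

lemma net_states_update_affine:
  assumes G: "G \<in> net_states K w"
  shows "(\<lambda>x. (G x)(i := (\<Sum>j<w. a j * G x j) + c)) \<in> net_states K w"
proof -
  from G obtain B h where B: "\<forall>x\<in>K. \<forall>i<w. \<bar>G x i\<bar> \<le> B" and h: "h \<in> hidden_states w"
    and aff: "\<forall>i<w. (\<lambda>x. G x i) \<in> affine_readouts K w h" by (auto simp: net_states_def)
  from affine_functional_bounded[OF B] obtain C where C: "\<forall>x\<in>K. \<bar>(\<Sum>j<w. a j * G x j) + c\<bar> \<le> C"
    by blast
  show ?thesis unfolding net_states_def
  proof (intro CollectI conjI exI[of _ "max B C"] bexI[OF _ h] ballI allI impI)
    fix k assume k: "k < w"
    show "(\<lambda>x. ((G x)(i := (\<Sum>j<w. a j * G x j) + c)) k) \<in> affine_readouts K w h"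
      using aff k by (cases "k = i")
        (auto intro!: affine_readouts_add affine_readouts_sum affine_readouts_mult affine_readouts_const)
  qed (use B C in \<open>auto simp: le_max_iff_disj\<close>)
qed

text \<open>The untouched coordinates pass through the activation as ReLU (t + B) - B, which is the
  identity because states are bounded on K.\<close>
lemma net_states_update_act:
  assumes G: "G \<in> net_states K w"
  shows "(\<lambda>x. (G x)(i := act r ((\<Sum>j<w. a j * G x j) + c))) \<in> net_states K w"
proof -
  from G obtain B h where B: "\<forall>x\<in>K. \<forall>i<w. \<bar>G x i\<bar> \<le> B" and h: "h \<in> hidden_states w"
    and aff: "\<forall>i<w. (\<lambda>x. G x i) \<in> affine_readouts K w h" by (auto simp: net_states_def)
  from affine_functional_bounded[OF B] obtain C where C: "\<forall>x\<in>K. \<bar>(\<Sum>j<w. a j * G x j) + c\<bar> \<le> C"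
    by blast
  define pre where "pre = (\<lambda>l x. if l = i then (\<Sum>j<w. a j * G x j) + c else G x l + B)"
  have "\<forall>l. \<exists>A d. l < w \<longrightarrow> (\<forall>x\<in>K. pre l x = (\<Sum>j<w. A j * h x j) + d)"
  proof
    fix l
    have "pre l \<in> affine_readouts K w h" if "l < w"
      unfolding pre_def using aff that by (cases "l = i")
        (auto intro!: affine_readouts_add affine_readouts_sum affine_readouts_mult affine_readouts_const)
    then show "\<exists>A d. l < w \<longrightarrow> (\<forall>x\<in>K. pre l x = (\<Sum>j<w. A j * h x j) + d)"
      by (auto simp: affine_readouts_def)
  qed
  then obtain A d where A: "\<And>l x. l < w \<Longrightarrow> x \<in> K \<Longrightarrow> pre l x = (\<Sum>j<w. A l j * h x j) + d l"
    by metis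
  define h' where "h' = (\<lambda>x l. if l < w then act (l = i \<longrightarrow> r) ((\<Sum>j<w. A l j * h x j) + d l) else 0)"
  have h': "h' \<in> hidden_states w" unfolding h'_def by (rule hidden_states_layer[OF h])
  have h'_eq: "h' x l = act (l = i \<longrightarrow> r) (pre l x)" if "l < w" "x \<in> K" for l x
    using that A by (simp add: h'_def)
  show ?thesis unfolding net_states_def
  proof (intro CollectI conjI exI[of _ "max B (max C 1)"] bexI[OF _ h'] ballI allI impI)
    fix k assume k: "k < w"
    have "(\<lambda>x. h' x k + (if k = i then 0 else - B)) \<in> affine_readouts K w h'"
      by (intro affine_readouts_add affine_readouts_coord affine_readouts_const k)
    then show "(\<lambda>x. ((G x)(i := act r ((\<Sum>j<w. a j * G x j) + c))) k) \<in> affine_readouts K w h'"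
    proof (rule affine_readouts_cong)
      fix x assume x: "x \<in> K"
      then have "\<bar>G x k\<bar> \<le> B" using B k by blast
      then show "((G x)(i := act r ((\<Sum>j<w. a j * G x j) + c))) k = h' x k + (if k = i then 0 else - B)"
        using k x by (auto simp: h'_eq pre_def act_def)
    qed
  next
    fix x k assume "x \<in> K" "k < w"
    with B C have "\<bar>G x k\<bar> \<le> B" "\<bar>(\<Sum>j<w. a j * G x j) + c\<bar> \<le> C" by auto
    then show "\<bar>((G x)(i := act r ((\<Sum>j<w. a j * G x j) + c))) k\<bar> \<le> max B (max C 1)"
      by (auto simp: act_def)
  qed
qed

lemma net_states_update_act2:
  assumes G: "G \<in> net_states K w" and "i < w" "j < w" "i \<noteq> j"
  shows "(\<lambda>x. (G x)(k := act r (\<alpha> * G x i + \<beta> * G x j + c))) \<in> net_states K w"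
proof -
  have "(\<Sum>l<w. (if l = i then \<alpha> else if l = j then \<beta> else 0) * G x l)
      = (\<Sum>l\<in>{i,j}. (if l = i then \<alpha> else if l = j then \<beta> else 0) * G x l)" for x
    using assms by (intro sum.mono_neutral_right) auto
  then have "(\<Sum>l<w. (if l = i then \<alpha> else if l = j then \<beta> else 0) * G x l) = \<alpha> * G x i + \<beta> * G x j" for x
    using assms(4) by auto
  then show ?thesis
    using net_states_update_act[OF G, of k r "\<lambda>l. if l = i then \<alpha> else if l = j then \<beta> else 0" c]
    by simp
qed

lemma net_states_update_affine2:
  assumes G: "G \<in> net_states K w" and "i < w" "j < w" "i \<noteq> j"
  shows "(\<lambda>x. (G x)(k := \<alpha> * G x i + \<beta> * G x j + c)) \<in> net_states K w"
proof -
  have "(\<Sum>l<w. (if l = i then \<alpha> else if l = j then \<beta> else 0) * G x l)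
      = (\<Sum>l\<in>{i,j}. (if l = i then \<alpha> else if l = j then \<beta> else 0) * G x l)" for x
    using assms by (intro sum.mono_neutral_right) auto
  then have "(\<Sum>l<w. (if l = i then \<alpha> else if l = j then \<beta> else 0) * G x l) = \<alpha> * G x i + \<beta> * G x j" for x
    using assms(4) by auto
  then show ?thesis
    using net_states_update_affine[OF G, of k "\<lambda>l. if l = i then \<alpha> else if l = j then \<beta> else 0" c]
    by simp
qed

lemma net_states_input:
  fixes K :: "(real^'n::finite) set"
  assumes "bounded K"
  shows "(\<lambda>x i. (\<Sum>k\<in>UNIV. A i k * x $ k)) \<in> net_states K w"
proof -
  obtain R where R: "\<forall>x\<in>K. norm x \<le> R" using assms by (auto simp: bounded_iff)
  define B where "B = (\<Sum>i<w. \<Sum>k\<in>UNIV. \<bar>A i k\<bar> * R)"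
  have B: "\<bar>\<Sum>k\<in>UNIV. A i k * x $ k\<bar> \<le> B" if "x \<in> K" "i < w" for x i
  proof -
    have "R \<ge> 0" using R that(1) norm_ge_zero order_trans by blast
    have "\<bar>\<Sum>k\<in>UNIV. A i k * x $ k\<bar> \<le> (\<Sum>k\<in>UNIV. \<bar>A i k\<bar> * R)"
    proof (intro order_trans[OF sum_abs] sum_mono)
      fix k
      have "\<bar>x $ k\<bar> \<le> R" using R that(1) component_le_norm_cart[of x k] by force
      then show "\<bar>A i k * x $ k\<bar> \<le> \<bar>A i k\<bar> * R" by (simp add: abs_mult mult_left_mono)
    qed
    also have "\<dots> \<le> B" unfolding B_def
      using that(2) \<open>R \<ge> 0\<close> by (intro member_le_sum[of i "{..<w}" "\<lambda>i. \<Sum>k\<in>UNIV. \<bar>A i k\<bar> * R"]) (auto intro!: sum_nonneg)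
    finally show ?thesis .
  qed
  define h where "h = (\<lambda>x i. if i < w then act True ((\<Sum>k\<in>UNIV. A i k * x $ k) + B) else 0)"
  have h: "h \<in> hidden_states w"
    unfolding hidden_states_def h_def
    by (intro CollectI exI[of _ A] exI[of _ "\<lambda>_. B"] exI[of _ "\<lambda>_. True"] exI[of _ "[]"]) simp
  show ?thesis unfolding net_states_def
  proof (intro CollectI conjI exI[of _ B] bexI[OF _ h] ballI allI impI)
    fix i assume i: "i < w"
    have "(\<lambda>x. h x i + - B) \<in> affine_readouts K w h"
      by (intro affine_readouts_add affine_readouts_coord affine_readouts_const i)
    then show "(\<lambda>x. \<Sum>k\<in>UNIV. A i k * x $ k) \<in> affine_readouts K w h"
    proof (rule affine_readouts_cong)
      fix x assume "x \<in> K"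
      then show "(\<Sum>k\<in>UNIV. A i k * x $ k) = h x i + - B"
        using B[of x i] i by (simp add: h_def act_def)
    qed
  qed (use B in auto)
qed

lemma net_states_output:
  fixes K :: "(real^'n::finite) set" and e :: "'m::finite \<Rightarrow> nat"
  assumes G: "G \<in> net_states K w" and e: "\<And>k. e k < w"
  shows "\<exists>g\<in>relu_step_nets_of_width w. \<forall>x\<in>K. \<forall>k::'m. g x $ k = G x (e k)"
proof -
  from G obtain h where h: "h \<in> hidden_states w"
    and aff: "\<forall>i<w. (\<lambda>x. G x i) \<in> affine_readouts K w h" by (auto simp: net_states_def)
  have "\<forall>k. \<exists>a c. \<forall>x\<in>K. G x (e k) = (\<Sum>j<w. a j * h x j) + c"
    using aff e by (auto simp: affine_readouts_def)
  then obtain WL bL where WL: "\<And>k x. x \<in> K \<Longrightarrow> G x (e k) = (\<Sum>j<w. WL k j * h x j) + bL k"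
    by metis
  from h obtain W b r Ls where Ls: "\<forall>L\<in>set Ls. fst L = w"
    and h: "h = (\<lambda>x. snd (hidden_apply w Ls
            (\<lambda>i. if i < w then act (r i) ((\<Sum>j\<in>UNIV. W i j * x $ j) + b i) else 0)))"
    by (auto simp: hidden_states_def)
  have "net_width w Ls = w"
    unfolding net_width_def using Ls by (intro Max_eqI) auto
  moreover have "relu_step_net w W b r Ls WL bL x $ k = G x (e k)" if "x \<in> K" for x and k :: 'm
    using WL[OF that, of k] by (simp add: relu_step_net_def case_prod_beta fst_hidden_apply_eq[OF Ls] h)
  ultimately show ?thesis
    unfolding relu_step_nets_of_width_def by blast
qed

section \<open>Quantisation and memorisation\<close>

lemma net_states_collapse_interval:
  assumes G: "G \<in> net_states K w" and ij: "i < w" "s < w" "i \<noteq> s"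
  shows "\<exists>H\<in>net_states K w. \<forall>x\<in>K. (\<forall>l. l \<noteq> i \<longrightarrow> l \<noteq> s \<longrightarrow> H x l = G x l) \<and>
    H x i = (if G x i < b then min (G x i) c else G x i)"
proof -
  from G obtain B where B: "\<forall>x\<in>K. \<forall>i<w. \<bar>G x i\<bar> \<le> B" by (auto simp: net_states_def)
  define B' where "B' = B + \<bar>c\<bar>"
  define G1 where "G1 = (\<lambda>x. (G x)(s := act False (1 * G x i + 0 * G x s + - b)))"
  define G2 where "G2 = (\<lambda>x. (G1 x)(s := act True (1 * G1 x i + (- B') * G1 x s + - c)))"
  define G3 where "G3 = (\<lambda>x. (G2 x)(i := 1 * G2 x i + (-1) * G2 x s + 0))"
  have "G1 \<in> net_states K w" unfolding G1_def by (intro net_states_update_act2 G ij)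
  then have "G2 \<in> net_states K w" unfolding G2_def by (intro net_states_update_act2 ij)
  then have "G3 \<in> net_states K w" unfolding G3_def by (intro net_states_update_affine2 ij)
  moreover have "G3 x i = (if G x i < b then min (G x i) c else G x i)" if "x \<in> K" for x
  proof -
    have "\<bar>G x i\<bar> \<le> B" using B that ij by blast
    then show ?thesis using ij(3) by (auto simp: G3_def G2_def G1_def act_def B'_def)
  qed
  moreover have "G3 x l = G x l" if "l \<noteq> i" "l \<noteq> s" for x l
    using that by (simp add: G3_def G2_def G1_def)
  ultimately show ?thesis by (intro bexI[of _ G3]) auto
qed

lemma net_states_quantise_coordinate:
  assumes G: "G \<in> net_states K w" and ij: "i < w" "s < w" "i \<noteq> s" and "\<delta> > 0"
  shows "\<exists>H\<in>net_states K w. (\<forall>x\<in>K. (\<forall>l. l \<noteq> i \<longrightarrow> l \<noteq> s \<longrightarrow> H x l = G x l) \<and>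
    \<bar>H x i - G x i\<bar> \<le> \<delta>) \<and> finite ((\<lambda>x. H x i) ` K)"
proof -
  from G obtain B where B: "\<forall>x\<in>K. \<forall>i<w. \<bar>G x i\<bar> \<le> B" by (auto simp: net_states_def)
  define \<theta> where "\<theta> = (\<lambda>k::nat. - B + real k * \<delta>)"
  have step: "\<exists>H\<in>net_states K w. \<forall>x\<in>K. (\<forall>l. l \<noteq> i \<longrightarrow> l \<noteq> s \<longrightarrow> H x l = G x l) \<and>
    (if G x i < \<theta> k then H x i \<in> \<theta> ` {..<k} \<and> \<bar>H x i - G x i\<bar> \<le> \<delta> else H x i = G x i)" for k
  proof (induction k)
    case 0
    have "\<not> G x i < \<theta> 0" if "x \<in> K" for x
    proof -
      have "\<bar>G x i\<bar> \<le> B" using B that ij by blast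
      then show ?thesis by (simp add: \<theta>_def)
    qed
    then show ?case using G by (intro bexI[of _ G]) auto
  next
    case (Suc k)
    then obtain H where H: "H \<in> net_states K w"
      and Hl: "\<And>x l. x \<in> K \<Longrightarrow> l \<noteq> i \<Longrightarrow> l \<noteq> s \<Longrightarrow> H x l = G x l"
      and Hi: "\<And>x. x \<in> K \<Longrightarrow> if G x i < \<theta> k then H x i \<in> \<theta> ` {..<k} \<and> \<bar>H x i - G x i\<bar> \<le> \<delta> else H x i = G x i"
      by blast
    from net_states_collapse_interval[OF H ij, of "\<theta> (Suc k)" "\<theta> k"] obtain H' where H': "H' \<in> net_states K w"
      and H'l: "\<And>x l. x \<in> K \<Longrightarrow> l \<noteq> i \<Longrightarrow> l \<noteq> s \<Longrightarrow> H' x l = H x l"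
      and H'i: "\<And>x. x \<in> K \<Longrightarrow> H' x i = (if H x i < \<theta> (Suc k) then min (H x i) (\<theta> k) else H x i)"
      by blast
    have \<theta>Suc: "\<theta> (Suc k) = \<theta> k + \<delta>" by (simp add: \<theta>_def algebra_simps)
    have \<theta>less: "\<theta> j < \<theta> k" if "j < k" for j using that \<open>\<delta> > 0\<close> by (simp add: \<theta>_def)
    have "if G x i < \<theta> (Suc k) then H' x i \<in> \<theta> ` {..<Suc k} \<and> \<bar>H' x i - G x i\<bar> \<le> \<delta> else H' x i = G x i"
      if x: "x \<in> K" for x
    proof (cases "G x i < \<theta> k")
      case True
      then have "H x i \<in> \<theta> ` {..<k}" "\<bar>H x i - G x i\<bar> \<le> \<delta>" using Hi[OF x] by auto
      moreover from this have "H x i < \<theta> k" using \<theta>less by auto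
      ultimately show ?thesis using True H'i[OF x] \<theta>Suc \<open>\<delta> > 0\<close> by auto
    next
      case False
      then have "H x i = G x i" using Hi[OF x] by simp
      then show ?thesis using False H'i[OF x] \<theta>Suc \<open>\<delta> > 0\<close> by auto
    qed
    then show ?case using H' H'l Hl by (intro bexI[of _ H']) auto
  qed
  obtain N :: nat where "2 * B / \<delta> < real N" using reals_Archimedean2 by blast
  then have N: "B < \<theta> N" using \<open>\<delta> > 0\<close> by (simp add: \<theta>_def field_simps)
  from step[of N] obtain H where H: "H \<in> net_states K w"
      and Hl: "\<And>x l. x \<in> K \<Longrightarrow> l \<noteq> i \<Longrightarrow> l \<noteq> s \<Longrightarrow> H x l = G x l"
      and Hi: "\<And>x. x \<in> K \<Longrightarrow> if G x i < \<theta> N then H x i \<in> \<theta> ` {..<N} \<and> \<bar>H x i - G x i\<bar> \<le> \<delta> else H x i = G x i"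
    by blast
  have *: "H x i \<in> \<theta> ` {..<N}" "\<bar>H x i - G x i\<bar> \<le> \<delta>" if "x \<in> K" for x
  proof -
    have "\<bar>G x i\<bar> \<le> B" using B that ij by blast
    then show "H x i \<in> \<theta> ` {..<N}" "\<bar>H x i - G x i\<bar> \<le> \<delta>" using Hi[OF that] N by (auto split: if_splits)
  qed
  then have "finite ((\<lambda>x. H x i) ` K)" by (auto intro: finite_subset[of _ "\<theta> ` {..<N}"])
  then show ?thesis using H Hl * by (intro bexI[of _ H]) auto
qed

lemma net_states_quantise:
  assumes G: "G \<in> net_states K w" and "s < w" "n \<le> s" "\<delta> > 0"
  shows "\<exists>H\<in>net_states K w. \<forall>i<n. (\<forall>x\<in>K. \<bar>H x i - G x i\<bar> \<le> \<delta>) \<and> finite ((\<lambda>x. H x i) ` K)"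
proof -
  have "k \<le> n \<Longrightarrow> \<exists>H\<in>net_states K w. (\<forall>i<k. (\<forall>x\<in>K. \<bar>H x i - G x i\<bar> \<le> \<delta>) \<and> finite ((\<lambda>x. H x i) ` K))
    \<and> (\<forall>i<n. k \<le> i \<longrightarrow> (\<forall>x\<in>K. H x i = G x i))" for k
  proof (induction k)
    case 0
    then show ?case using G by auto
  next
    case (Suc k)
    obtain H where H: "H \<in> net_states K w"
      and lt: "\<forall>i<k. (\<forall>x\<in>K. \<bar>H x i - G x i\<bar> \<le> \<delta>) \<and> finite ((\<lambda>x. H x i) ` K)"
      and ge: "\<forall>i<n. k \<le> i \<longrightarrow> (\<forall>x\<in>K. H x i = G x i)"
      using Suc.IH[OF Suc_leD[OF Suc.prems]] by blast
    have "k < w" "k \<noteq> s" using Suc.prems assms by auto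
    from net_states_quantise_coordinate[OF H this(1) assms(2) this(2) \<open>\<delta> > 0\<close>]
    obtain H' where H': "H' \<in> net_states K w"
      and l: "\<And>x l. x \<in> K \<Longrightarrow> l \<noteq> k \<Longrightarrow> l \<noteq> s \<Longrightarrow> H' x l = H x l"
      and k: "\<And>x. x \<in> K \<Longrightarrow> \<bar>H' x k - H x k\<bar> \<le> \<delta>" and fin: "finite ((\<lambda>x. H' x k) ` K)" by blast
    have "(\<forall>x\<in>K. \<bar>H' x i - G x i\<bar> \<le> \<delta>) \<and> finite ((\<lambda>x. H' x i) ` K)" if "i < Suc k" for i
    proof (cases "i = k")
      case True
      then show ?thesis using k ge Suc.prems fin by auto
    next
      case False
      then have i: "i < k" "i \<noteq> s" using that Suc.prems assms by auto
      then have "(\<lambda>x. H' x i) ` K = (\<lambda>x. H x i) ` K" using l by (intro image_cong) auto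
      then show ?thesis using lt i l[of _ i] by auto
    qed
    moreover have "H' x i = G x i" if "i < n" "Suc k \<le> i" "x \<in> K" for i x
      using that ge l[of x i] assms(3) by auto
    ultimately show ?case using H' by blast
  qed
  from this[of n] show ?thesis by blast
qed

text \<open>The values of coordinate i are treated in increasing order. For a value b, taking first the
  maximum and then the minimum with steep lines through (b, \<phi> b) sets coordinate j right at b and
  leaves it alone at all smaller values; what happens at larger values is repaired later.\<close>
lemma net_states_memorise:
  assumes G: "G \<in> net_states K w" and ij: "i < w" "j < w" "i \<noteq> j" and fin: "finite ((\<lambda>x. G x i) ` K)"
  shows "(\<lambda>x. (G x)(j := \<phi> (G x i))) \<in> net_states K w"
proof -
  have "finite V \<Longrightarrow> \<exists>H\<in>net_states K w. \<forall>x\<in>K. (\<forall>l. l \<noteq> j \<longrightarrow> H x l = G x l) \<and> (G x i \<in> V \<longrightarrow> H x j = \<phi> (G x i))" for V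
  proof (induction V rule: finite_linorder_max_induct)
    case empty
    then show ?case using G by auto
  next
    case (insert b V)
    then obtain H where H: "H \<in> net_states K w" and Hl: "\<And>x l. x \<in> K \<Longrightarrow> l \<noteq> j \<Longrightarrow> H x l = G x l"
      and Hj: "\<And>x. x \<in> K \<Longrightarrow> G x i \<in> V \<Longrightarrow> H x j = \<phi> (G x i)" by blast
    have "bdd_above ((\<lambda>a. \<bar>\<phi> a - \<phi> b\<bar> / (b - a)) ` V)" using insert.hyps by simp
    then obtain m where m: "\<And>a. a \<in> V \<Longrightarrow> \<bar>\<phi> a - \<phi> b\<bar> / (b - a) \<le> m" by (auto simp: bdd_above_def)
    have steep: "\<bar>\<phi> a - \<phi> b\<bar> \<le> m * (b - a)" if "a \<in> V" for a
      using m[OF that] insert.hyps(2) that by (simp add: pos_divide_le_eq)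
    define H1 where "H1 = (\<lambda>x. (H x)(j := act True ((- m) * H x i + 1 * H x j + (m * b - \<phi> b))))"
    define H2 where "H2 = (\<lambda>x. (H1 x)(j := m * H1 x i + 1 * H1 x j + (\<phi> b - m * b)))"
    define H3 where "H3 = (\<lambda>x. (H2 x)(j := act True ((- m) * H2 x i + (-1) * H2 x j + (m * b + \<phi> b))))"
    define H4 where "H4 = (\<lambda>x. (H3 x)(j := (- m) * H3 x i + (-1) * H3 x j + (m * b + \<phi> b)))"
    have "H1 \<in> net_states K w" unfolding H1_def by (intro net_states_update_act2 H ij)
    then have "H2 \<in> net_states K w" unfolding H2_def by (intro net_states_update_affine2 ij)
    then have "H3 \<in> net_states K w" unfolding H3_def by (intro net_states_update_act2 ij)
    then have H4: "H4 \<in> net_states K w" unfolding H4_def by (intro net_states_update_affine2 ij)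
    have H4j: "H4 x j = min (max (H x j) (\<phi> b - m * (b - G x i))) (\<phi> b + m * (b - G x i))" if "x \<in> K" for x
    proof -
      have i: "H x i = G x i" "H1 x i = G x i" "H2 x i = G x i" "H3 x i = G x i"
        using ij(3) Hl[OF that, of i] by (auto simp: H3_def H2_def H1_def)
      have "H2 x j = (\<phi> b - m * (b - G x i)) + act True (H x j - (\<phi> b - m * (b - G x i)))"
        using i(1) ij(3) by (simp add: H2_def H1_def algebra_simps)
      then have "H2 x j = max (H x j) (\<phi> b - m * (b - G x i))"
        by (simp add: act_def max_def)
      moreover have "H4 x j = (\<phi> b + m * (b - G x i)) - act True ((\<phi> b + m * (b - G x i)) - H2 x j)"
        using i(3,4) ij(3) by (simp add: H4_def H3_def algebra_simps)
      ultimately show ?thesis by (simp add: act_def min_def max_def)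
    qed
    have "H4 x j = \<phi> (G x i)" if x: "x \<in> K" "G x i \<in> insert b V" for x
    proof (cases "G x i = b")
      case True
      then show ?thesis using H4j[OF x(1)] by simp
    next
      case False
      then have "G x i \<in> V" using x by simp
      with steep[OF this] Hj[OF x(1) this] show ?thesis using H4j[OF x(1)] by simp
    qed
    moreover have "H4 x l = G x l" if "x \<in> K" "l \<noteq> j" for x l
      using that Hl by (simp add: H4_def H3_def H2_def H1_def)
    ultimately show ?case using H4 by blast
  qed
  from this[OF fin] obtain H where "H \<in> net_states K w"
    "\<forall>x\<in>K. (\<forall>l. l \<noteq> j \<longrightarrow> H x l = G x l) \<and> H x j = \<phi> (G x i)" by blast
  then show ?thesis by (elim net_states_cong) auto
qed

section \<open>Injective codes and density\<close>

lemma injective_small_combination: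
  fixes P :: "(real \<times> real) set"
  assumes "finite P" "\<eta> > 0"
  shows "\<exists>t. 0 < t \<and> t < \<eta> \<and> inj_on (\<lambda>(u, v). u + t * v) P"
proof -
  define bad where "bad = (\<lambda>(p, q). (fst q - fst p) / (snd p - snd q)) ` (P \<times> P)"
  have "finite bad" unfolding bad_def using assms(1) by simp
  moreover have "infinite {0<..<\<eta>}" using assms(2) by (rule infinite_Ioo)
  ultimately obtain t where t: "t \<in> {0<..<\<eta>}" "t \<notin> bad" by (meson finite_subset subsetI)
  have "inj_on (\<lambda>(u, v). u + t * v) P"
  proof (rule inj_onI, clarsimp)
    fix u v u' v' assume P: "(u, v) \<in> P" "(u', v') \<in> P" and eq: "u + t * v = u' + t * v'"
    have "v = v'"
    proof (rule ccontr)
      assume "v \<noteq> v'"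
      then have "t = (u' - u) / (v - v')" using eq by (simp add: field_simps)
      then have "t \<in> bad" unfolding bad_def using P by (auto intro!: image_eqI[of _ _ "((u, v), (u', v'))"])
      then show False using t by simp
    qed
    then show "u = u' \<and> v = v'" using eq by simp
  qed
  then show ?thesis using t(1) by auto
qed

lemma injective_linear_code:
  fixes H :: "'a \<Rightarrow> nat \<Rightarrow> real"
  assumes "\<forall>i<n. finite ((\<lambda>x. H x i) ` K)"
  shows "\<exists>a. finite ((\<lambda>x. \<Sum>i<n. a i * H x i) ` K) \<and>
    (\<forall>x\<in>K. \<forall>y\<in>K. (\<Sum>i<n. a i * H x i) = (\<Sum>i<n. a i * H y i) \<longrightarrow> (\<forall>i<n. H x i = H y i))"
  using assms
proof (induction n)
  case 0
  then show ?case by (auto intro: finite_subset[of _ "{0}"])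
next
  case (Suc n)
  have "\<forall>i<n. finite ((\<lambda>x. H x i) ` K)" using Suc.prems by simp
  from Suc.IH[OF this] obtain a where fin: "finite ((\<lambda>x. \<Sum>i<n. a i * H x i) ` K)"
    and inj: "\<And>x y i. x \<in> K \<Longrightarrow> y \<in> K \<Longrightarrow> (\<Sum>i<n. a i * H x i) = (\<Sum>i<n. a i * H y i) \<Longrightarrow> i < n \<Longrightarrow> H x i = H y i"
    by blast
  define P where "P = (\<lambda>x. (\<Sum>i<n. a i * H x i, H x n)) ` K"
  have "P \<subseteq> ((\<lambda>x. \<Sum>i<n. a i * H x i) ` K) \<times> ((\<lambda>x. H x n) ` K)" by (auto simp: P_def)
  then have finP: "finite P" using fin Suc.prems by (auto intro: finite_subset)
  from injective_small_combination[OF finP, of 1] obtain t where t: "inj_on (\<lambda>(u, v). u + t * v) P" by auto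
  let ?a = "a(n := t)"
  have sum: "(\<Sum>i<Suc n. ?a i * H x i) = (\<lambda>(u, v). u + t * v) (\<Sum>i<n. a i * H x i, H x n)" for x
    by (simp add: sum.cong[of "{..<n}" "{..<n}" "\<lambda>i. ?a i * H x i" "\<lambda>i. a i * H x i"])
  have "finite ((\<lambda>x. \<Sum>i<Suc n. ?a i * H x i) ` K)"
    unfolding sum using finite_imageI[OF finP, of "\<lambda>(u, v). u + t * v"] by (simp only: P_def image_image)
  moreover have "H x i = H y i" if xy: "x \<in> K" "y \<in> K" and i: "i < Suc n"
    and eq: "(\<Sum>i<Suc n. ?a i * H x i) = (\<Sum>i<Suc n. ?a i * H y i)" for x y i
  proof -
    have "(\<Sum>i<n. a i * H x i, H x n) = (\<Sum>i<n. a i * H y i, H y n)"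
      using eq xy unfolding sum by (intro inj_onD[OF t]) (auto simp: P_def)
    then show ?thesis using inj[OF xy, of i] i by (auto simp: less_Suc_eq)
  qed
  ultimately show ?case by blast
qed

lemma wide_nets_dense:
  fixes K :: "(real^'n) set"
  assumes "compact K" and w: "CARD('n) + 1 \<le> w" "CARD('m) \<le> w"
  shows "dense_in_C K (relu_step_nets_of_width w :: (real^'n \<Rightarrow> real^'m) set)"
  unfolding dense_in_C_def
proof (intro allI impI)
  fix f :: "real^'n \<Rightarrow> real^'m" and \<epsilon> :: real
  assume f: "continuous_on K f" and \<epsilon>: "\<epsilon> > 0"
  have "uniformly_continuous_on K f" using f assms(1) by (rule compact_uniformly_continuous)
  then obtain d where d: "d > 0" "\<And>x y. x \<in> K \<Longrightarrow> y \<in> K \<Longrightarrow> dist y x < d \<Longrightarrow> dist (f y) (f x) < \<epsilon> / 2"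
    using \<epsilon> unfolding uniformly_continuous_on_def by (metis half_gt_zero)
  let ?n = "CARD('n)"
  have n0: "0 < ?n" by simp
  obtain e :: "'n \<Rightarrow> nat" where e: "bij_betw e UNIV {..<?n}"
    using ex_bij_betw_finite_nat[of "UNIV :: 'n set"] by (auto simp: atLeast0LessThan)
  obtain e' :: "'m \<Rightarrow> nat" where e': "bij_betw e' UNIV {..<CARD('m)}"
    using ex_bij_betw_finite_nat[of "UNIV :: 'm set"] by (auto simp: atLeast0LessThan)
  have e_lt: "e k < ?n" for k using e by (auto simp: bij_betw_def)
  have e'_lt: "e' k < w" for k using bij_betwE[OF e'] w(2) by (meson UNIV_I lessThan_iff order_less_le_trans)
  define \<delta> where "\<delta> = d / (4 * real ?n)"
  have \<delta>: "\<delta> > 0" using d n0 by (simp add: \<delta>_def)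
  define G0 where "G0 = (\<lambda>(x::real^'n) i. (\<Sum>k\<in>UNIV. (if e k = i then 1 else 0) * x $ k))"
  have G0: "G0 \<in> net_states K w" unfolding G0_def
    by (rule net_states_input) (use assms(1) compact_imp_bounded in blast)
  have G0e: "G0 x (e k) = x $ k" for x k
  proof -
    have "e l = e k \<longleftrightarrow> l = k" for l using e by (auto simp: bij_betw_def inj_on_def)
    then show ?thesis by (simp add: G0_def if_distrib[of "\<lambda>a. a * _"] cong: if_cong)
  qed
  from net_states_quantise[OF G0, of ?n ?n \<delta>] w \<delta> obtain H where H: "H \<in> net_states K w"
    and close: "\<And>i x. i < ?n \<Longrightarrow> x \<in> K \<Longrightarrow> \<bar>H x i - G0 x i\<bar> \<le> \<delta>"
    and fin: "\<forall>i<?n. finite ((\<lambda>x. H x i) ` K)" by (auto simp: Suc_le_eq)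
  from injective_linear_code[OF fin] obtain a where
    finu: "finite ((\<lambda>x. \<Sum>i<?n. a i * H x i) ` K)" and
    inju: "\<And>x y i. x \<in> K \<Longrightarrow> y \<in> K \<Longrightarrow> (\<Sum>i<?n. a i * H x i) = (\<Sum>i<?n. a i * H y i) \<Longrightarrow> i < ?n \<Longrightarrow> H x i = H y i"
    by blast
  define u where "u = (\<lambda>x. \<Sum>i<?n. a i * H x i)"
  have same: "dist (f y) (f x) < \<epsilon> / 2" if xy: "x \<in> K" "y \<in> K" "u x = u y" for x y
  proof (rule d(2)[OF xy(1,2)])
    have "\<bar>(y - x) $ k\<bar> \<le> 2 * \<delta>" for k
      using close[OF e_lt[of k] xy(1)] close[OF e_lt[of k] xy(2)]
        inju[OF xy(1,2) _ e_lt[of k]] xy(3) unfolding u_def G0e by (simp add: abs_le_iff)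
    then have "(\<Sum>k\<in>UNIV. \<bar>(y - x) $ k\<bar>) \<le> (\<Sum>k\<in>(UNIV::'n set). 2 * \<delta>)" by (intro sum_mono)
    then have "norm (y - x) \<le> d / 2"
      using norm_le_l1_cart[of "y - x"] n0 by (simp add: \<delta>_def)
    then show "dist y x < d" using d(1) by (simp add: dist_norm)
  qed
  define rep where "rep = (\<lambda>v. SOME x. x \<in> K \<and> u x = v)"
  have rep: "rep (u x) \<in> K" "u (rep (u x)) = u x" if "x \<in> K" for x
    unfolding rep_def using someI[of "\<lambda>z. z \<in> K \<and> u z = u x" x] that by auto
  obtain k0 where k0: "e' k0 = 0" using e' by (metis bij_betw_iff_bijections lessThan_iff zero_less_card_finite)
  have finu': "finite (u ` K)" using finu by (simp add: u_def)
  have "bdd_above (abs ` u ` K)" using finu' by simp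
  then obtain M where M: "\<And>x. x \<in> K \<Longrightarrow> \<bar>u x\<bar> \<le> M" by (auto simp: bdd_above_def)
  define \<eta> where "\<eta> = \<epsilon> / (2 * (\<bar>M\<bar> + 1))"
  have \<eta>: "\<eta> > 0" using \<epsilon> by (simp add: \<eta>_def)
  have finP: "finite ((\<lambda>v. (f (rep v) $ k0, v)) ` u ` K)" using finu' by simp
  from injective_small_combination[OF finP \<eta>] obtain t where t: "0 < t" "t < \<eta>"
    "inj_on (\<lambda>(u, v). u + t * v) ((\<lambda>v. (f (rep v) $ k0, v)) ` u ` K)" by blast
  text \<open>The first output coordinate is perturbed so that it still determines the code; it then
    replaces the code, whose coordinate becomes free for the remaining outputs.\<close>
  define y where "y = (\<lambda>v. f (rep v) $ k0 + t * v)"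
  have injy: "inj_on y (u ` K)" using t(3) unfolding y_def inj_on_def by auto
  have tu: "\<bar>t * u x\<bar> \<le> \<epsilon> / 2" if "x \<in> K" for x
  proof -
    have "\<bar>t * u x\<bar> \<le> \<eta> * (\<bar>M\<bar> + 1)"
      using M[OF that] t(1,2) unfolding abs_mult by (intro mult_mono) auto
    also have "\<dots> = \<epsilon> / 2" by (simp add: \<eta>_def field_simps)
    finally show ?thesis .
  qed
  define \<psi> where "\<psi> = (\<lambda>k z. f (rep (inv_into (u ` K) y z)) $ k)"
  have \<psi>: "\<psi> k (y (u x)) = f (rep (u x)) $ k" if "x \<in> K" for k x
    using that injy by (simp add: \<psi>_def)
  have w1: "1 < w" "0 < w" using w n0 by linarith+
  define H1 where "H1 = (\<lambda>x. (H x)(1 := (\<Sum>j<w. (if j < ?n then a j else 0) * H x j) + 0))"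
  have H1: "H1 \<in> net_states K w" unfolding H1_def by (rule net_states_update_affine[OF H])
  have H1u: "H1 x 1 = u x" for x
  proof -
    have "(\<Sum>j<w. (if j < ?n then a j else 0) * H x j) = (\<Sum>j<?n. a j * H x j)"
      using w(1) by (intro sum.mono_neutral_cong_right) auto
    then show ?thesis by (simp add: H1_def u_def)
  qed
  define H2 where "H2 = (\<lambda>x. (H1 x)(0 := y (H1 x 1)))"
  have H2: "H2 \<in> net_states K w" unfolding H2_def
    by (rule net_states_memorise[OF H1 w1]) (use finu' H1u in auto)
  have H20: "H2 x 0 = y (u x)" for x unfolding H2_def H1u by simp
  have "\<exists>H'\<in>net_states K w. \<forall>x\<in>K. H' x 0 = y (u x) \<and> (\<forall>k\<in>S. k \<noteq> k0 \<longrightarrow> H' x (e' k) = f (rep (u x)) $ k)"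
    if "finite S" for S
    using that
  proof (induction S)
    case empty
    then show ?case using H2 H20 by auto
  next
    case (insert k S)
    then obtain H' where H': "H' \<in> net_states K w" and H'0: "\<And>x. x \<in> K \<Longrightarrow> H' x 0 = y (u x)"
      and H'k: "\<And>x k. x \<in> K \<Longrightarrow> k \<in> S \<Longrightarrow> k \<noteq> k0 \<Longrightarrow> H' x (e' k) = f (rep (u x)) $ k" by blast
    have inj: "e' l = e' l' \<longleftrightarrow> l = l'" for l l' using e' by (auto simp: bij_betw_def inj_on_def)
    show ?case
    proof (cases "k = k0")
      case True
      then show ?thesis using H' H'0 H'k by (intro bexI[of _ H']) auto
    next
      case False
      then have ne: "0 \<noteq> e' k" using k0 inj by metis
      have "(\<lambda>x. H' x 0) ` K = y ` u ` K" using H'0 by (auto simp: image_image intro!: image_cong)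
      then have "finite ((\<lambda>x. H' x 0) ` K)" using finu' by simp
      from net_states_memorise[OF H' w1(2) e'_lt ne this, of "\<psi> k"]
      show ?thesis using H'0 H'k \<psi> ne inj
        by (intro bexI[of _ "\<lambda>x. (H' x)(e' k := \<psi> k (H' x 0))"]) auto
    qed
  qed
  from this[of UNIV] obtain H' where H': "H' \<in> net_states K w" and H'0: "\<And>x. x \<in> K \<Longrightarrow> H' x 0 = y (u x)"
      and H'k: "\<And>x k. x \<in> K \<Longrightarrow> k \<noteq> k0 \<Longrightarrow> H' x (e' k) = f (rep (u x)) $ k" by auto
  from net_states_output[OF H', of e', OF e'_lt] obtain g :: "real^'n \<Rightarrow> real^'m" where
    g: "g \<in> relu_step_nets_of_width w" "\<And>x k. x \<in> K \<Longrightarrow> g x $ k = H' x (e' k)" by blast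
  have "\<bar>f x $ k - g x $ k\<bar> \<le> \<epsilon>" if x: "x \<in> K" for x k
  proof -
    have "\<bar>(f x - f (rep (u x))) $ k\<bar> \<le> norm (f x - f (rep (u x)))" by (rule component_le_norm_cart)
    also have "\<dots> < \<epsilon> / 2" using same[OF rep(1)[OF x] x rep(2)[OF x]] by (simp add: dist_norm)
    finally have 1: "\<bar>f x $ k - f (rep (u x)) $ k\<bar> < \<epsilon> / 2" by simp
    have "\<bar>f (rep (u x)) $ k - g x $ k\<bar> \<le> \<epsilon> / 2"
    proof (cases "k = k0")
      case True
      then show ?thesis using g(2)[OF x, of k] H'0[OF x] k0 tu[OF x] by (simp add: y_def)
    next
      case False
      then show ?thesis using g(2)[OF x, of k] H'k[OF x] \<epsilon> by simp
    qed
    with 1 show ?thesis by linarith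
  qed
  then show "\<exists>g\<in>relu_step_nets_of_width w. \<forall>x\<in>K. \<forall>i. \<bar>f x $ i - g x $ i\<bar> \<le> \<epsilon>" using g(1) by blast
qed

theorem theorem3:
  fixes K :: "(real^'n) set" and w :: nat
  assumes "compact K" and "interior K \<noteq> {}"
  shows "dense_in_C K (relu_step_nets_of_width w :: (real^'n \<Rightarrow> real^'m) set)
         \<longleftrightarrow> w \<ge> max (CARD('n) + 1) CARD('m)"
proof
  assume "dense_in_C K (relu_step_nets_of_width w :: (real^'n \<Rightarrow> real^'m) set)"
  then show "max (CARD('n) + 1) CARD('m) \<le> w"
    using dense_imp_width_gt_input dense_imp_width_ge_output assms(2) by (metis max.bounded_iff)
next
  assume "max (CARD('n) + 1) CARD('m) \<le> w"
  then show "dense_in_C K (relu_step_nets_of_width w :: (real^'n \<Rightarrow> real^'m) set)"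
    using wide_nets_dense[OF assms(1)] by (metis max.bounded_iff)
qed

end
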